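(* For all sufficiently large integers $n$, there exists a (simple, undirected) graph $G$ on $n$ vertices with at least $\frac{n^2}{4}\left(1 - e^{-(\log n)^{1/6}}\right)$ edges such that every edge of $G$ is contained in at least one triangle of $G$, and no edge of $G$ is contained in more than $n^{14/\log\log n}$ triangles of $G$.
   Context: All logarithms are natural (base $e$). A triangle is a set of three pairwise adjacent vertices; an edge is contained in a triangle if both of its endpoints are vertices of that triangle. *)

theory Defs
  imports Complex_Main "HOL-Library.Ramsey"
begin

definition simple_graph :: "'a set \<Rightarrow> 'a set set \<Rightarrow> bool" where
  "simple_graph V E \<longleftrightarrow> E \<subseteq> [V]\<^bsup>2\<^esup>"

(* A triangle is identified with its vertex set, so each one is counted once. *)
definition triangles :: "'a set \<Rightarrow> 'a set set \<Rightarrow> 'a set set" where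
  "triangles V E = {T \<in> [V]\<^bsup>3\<^esup>. clique T E}"

(* An edge is the set of its endpoints, so containment in a triangle is inclusion. *)
definition triangles_containing :: "'a set \<Rightarrow> 'a set set \<Rightarrow> 'a set \<Rightarrow> 'a set set" where
  "triangles_containing V E e = {T \<in> triangles V E. e \<subseteq> T}"

end

theory Submission
  imports Defs "HOL-Real_Asymp.Real_Asymp"
begin

text \<open>
  Take two vertex classes inside the box \<open>{0..<r}\<close> to the power \<open>d\<close>, with \<open>r\<close> about the fifth root of
  \<open>ln n\<close> and \<open>d\<close> least with \<open>n \<le> r ^ d\<close>. Since \<open>d\<close> is much larger than \<open>r ^ 4\<close>, the squared distance
  of almost every pair \<open>x\<close>, \<open>y\<close> is within \<open>O(d)\<close> of its mean. Join such a pair, and join both points to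
  a vertex \<open>s\<close> of a third class, obtained by rounding \<open>x + y\<close> to a multiple of 3 in each coordinate;
  this class is smaller than the others by an exponential factor in \<open>d\<close>. By the parallelogram law, any two
  vertices of a triangle confine the third to the lattice points of a ball of squared radius \<open>2 d\<close>, of which
  there are at most \<open>12 ^ d\<close>. The theorem follows since \<open>d\<close> is about \<open>5 ln n / ln (ln n)\<close>
  and \<open>5 ln 12 < 14\<close>.
\<close>

section \<open>Tripartite unions of triangles\<close>

text \<open>Taking the union of the triangles \<open>{a, b, t a b}\<close> over \<open>P\<close>
  puts every edge in a triangle by construction. The union may contain further triangles, with edges
  from different pairs of \<open>P\<close>, so the hypotheses bound common neighbourhoods. As the
  classes are disjoint, the ends of an edge have common neighbours only in the third class.\<close>

lemma tripartite_triangle_graph: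
  fixes A B C V :: "'v set" and t :: "'v \<Rightarrow> 'v \<Rightarrow> 'v"
  defines "Q \<equiv> \<lambda>P. (\<lambda>(a,b). (a, t a b)) ` P" and "R \<equiv> \<lambda>P. (\<lambda>(a,b). (b, t a b)) ` P"
  assumes fin: "finite V" and sub: "A \<subseteq> V" "B \<subseteq> V" "C \<subseteq> V"
    and disj: "A \<inter> B = {}" "A \<inter> C = {}" "B \<inter> C = {}"
    and P: "P \<subseteq> A \<times> B" and t: "\<And>a b. (a, b) \<in> P \<Longrightarrow> t a b \<in> C"
    and AB: "\<And>a b. (a, b) \<in> P \<Longrightarrow> card {c. (a, c) \<in> Q P \<and> (b, c) \<in> R P} \<le> K"
    and AC: "\<And>a c. (a, c) \<in> Q P \<Longrightarrow> card {b. (a, b) \<in> P \<and> (b, c) \<in> R P} \<le> K"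
    and BC: "\<And>b c. (b, c) \<in> R P \<Longrightarrow> card {a. (a, b) \<in> P \<and> (a, c) \<in> Q P} \<le> K"
  shows "\<exists>E. simple_graph V E \<and> card P \<le> card E \<and>
    (\<forall>e\<in>E. 1 \<le> card (triangles_containing V E e) \<and> card (triangles_containing V E e) \<le> K)"
proof -
  define E where "E = {{a, b} | a b. (a, b) \<in> P} \<union> {{a, c} | a c. (a, c) \<in> Q P}
    \<union> {{b, c} | b c. (b, c) \<in> R P}"
  have Q: "Q P \<subseteq> A \<times> C" and R: "R P \<subseteq> B \<times> C"
    using P t unfolding Q_def R_def by auto
  have simple: "simple_graph V E"
    unfolding simple_graph_def E_def using P Q R sub disj by (auto simp: nsets_def card_insert_if)
  have finE: "finite E"
    using simple fin unfolding simple_graph_def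
    by (meson finite_imp_finite_nsets finite_subset)
  have adjA: "(z \<in> B \<and> (a, z) \<in> P) \<or> (z \<in> C \<and> (a, z) \<in> Q P)" if "{a, z} \<in> E" "a \<in> A" for a z
    using that P Q R disj unfolding E_def by (auto simp: doubleton_eq_iff)
  have adjB: "(z \<in> A \<and> (z, b) \<in> P) \<or> (z \<in> C \<and> (b, z) \<in> R P)" if "{b, z} \<in> E" "b \<in> B" for b z
    using that P Q R disj unfolding E_def by (auto simp: doubleton_eq_iff)
  have adjC: "(z \<in> A \<and> (z, c) \<in> Q P) \<or> (z \<in> B \<and> (z, c) \<in> R P)" if "{c, z} \<in> E" "c \<in> C" for c z
    using that P Q R disj unfolding E_def by (auto simp: doubleton_eq_iff)
  have third: "\<exists>z. T = {x, y, z} \<and> {x, z} \<in> E \<and> {y, z} \<in> E"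
    if T: "T \<in> triangles_containing V E {x, y}" and "x \<noteq> y" for T x y
  proof -
    have "card T = 3" "{x, y} \<subseteq> T" and cl: "clique T E" and "finite T"
      using T by (auto simp: triangles_containing_def triangles_def nsets_def)
    then have "card (T - {x, y}) = 1"
      using \<open>x \<noteq> y\<close> by (subst card_Diff_subset) auto
    then obtain z where z: "T - {x, y} = {z}"
      by (auto simp: card_1_singleton_iff)
    then show ?thesis
      using cl \<open>{x, y} \<subseteq> T\<close> \<open>x \<noteq> y\<close> by (intro exI[of _ z]) (auto simp: clique_def)
  qed
  \<comment> \<open>A triangle through \<open>{x, y}\<close> is determined by its third vertex, a
    common neighbour; \<open>S\<close> will be the set of those.\<close>
  have upper: "card (triangles_containing V E {x, y}) \<le> K"
    if "x \<noteq> y" "\<And>z. {x, z} \<in> E \<Longrightarrow> {y, z} \<in> E \<Longrightarrow> z \<in> S" "S \<subseteq> V" "card S \<le> K" for x y S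
  proof -
    have "finite S" using that(3) fin finite_subset by blast
    moreover have "triangles_containing V E {x, y} \<subseteq> (\<lambda>z. {x, y, z}) ` S"
      using third[OF _ that(1)] that(2) by blast
    ultimately show ?thesis
      by (meson surj_card_le order_trans that(4))
  qed
  have lower: "1 \<le> card (triangles_containing V E e)"
    if "(a, b) \<in> P" "e \<subseteq> {a, b, t a b}" for a b e
  proof -
    have "(a, t a b) \<in> Q P" "(b, t a b) \<in> R P"
      using that unfolding Q_def R_def by force+
    then have "{a, b} \<in> E" "{a, t a b} \<in> E" "{b, t a b} \<in> E"
      using that unfolding E_def by auto
    moreover have "a \<in> A" "b \<in> B" "t a b \<in> C"
      using that P t by auto
    moreover from this have "{a, b, t a b} \<in> [V]\<^bsup>3\<^esup>"
      using disj sub by (auto simp: nsets_def card_insert_if)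
    ultimately have "{a, b, t a b} \<in> triangles_containing V E e"
      using that by (auto simp: triangles_containing_def triangles_def clique_def insert_commute)
    moreover have "finite (triangles_containing V E e)"
      using fin by (auto simp: triangles_containing_def triangles_def finite_imp_finite_nsets)
    ultimately show ?thesis
      by (metis One_nat_def Suc_leI card_gt_0_iff empty_iff)
  qed
  have bounds: "1 \<le> card (triangles_containing V E e) \<and> card (triangles_containing V E e) \<le> K"
    if "e \<in> E" for e
  proof -
    from that consider (ab) a b where "e = {a, b}" "(a, b) \<in> P"
      | (ac) a c where "e = {a, c}" "(a, c) \<in> Q P" | (bc) b c where "e = {b, c}" "(b, c) \<in> R P"
      unfolding E_def by blast
    then show ?thesis
    proof cases
      case ab
      then have "a \<in> A" "b \<in> B" using P by auto
      \<comment> \<open>Neighbours of \<open>a\<close> lie in \<open>B\<close> or \<open>C\<close>,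
        those of \<open>b\<close> in \<open>A\<close> or \<open>C\<close>, so common ones lie in
        \<open>C\<close>. The other two cases are analogous.\<close>
      then have "card (triangles_containing V E {a, b}) \<le> K"
        using adjA[of a] adjB[of b] disj R sub
        by (intro upper[OF _ _ _ AB[OF ab(2)]]) blast+
      then show ?thesis using lower[OF ab(2), of e] ab by auto
    next
      case ac
      then have "a \<in> A" "c \<in> C" using Q by auto
      then have "card (triangles_containing V E {a, c}) \<le> K"
        using adjA[of a] adjC[of c] disj R sub
        by (intro upper[OF _ _ _ AC[OF ac(2)]]) blast+
      moreover obtain b where "(a, b) \<in> P" "c = t a b"
        using ac(2) unfolding Q_def by auto
      ultimately show ?thesis using lower[of a b e] ac by auto
    next
      case bc
      then have "b \<in> B" "c \<in> C" using R by auto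
      then have "card (triangles_containing V E {b, c}) \<le> K"
        using adjB[of b] adjC[of c] disj Q sub
        by (intro upper[OF _ _ _ BC[OF bc(2)]]) blast+
      moreover obtain a where "(a, b) \<in> P" "c = t a b"
        using bc(2) unfolding R_def by auto
      ultimately show ?thesis using lower[of a b e] bc by auto
    qed
  qed
  have "inj_on (\<lambda>(a, b). {a, b}) P"
    using P disj by (auto simp: inj_on_def doubleton_eq_iff; blast)
  moreover have "(\<lambda>(a, b). {a, b}) ` P \<subseteq> E"
    unfolding E_def by auto
  ultimately have "card P \<le> card E"
    using finE by (meson card_inj_on_le)
  with simple bounds show ?thesis by blast
qed

section \<open>Concentration and lattice points in a ball\<close>

text \<open>For negative \<open>x\<close>, the product
  \<open>(1 + x + x^2) * (1 - x) = 1 - x^3\<close> is at least 1, and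
  \<open>1 - x \<le> exp (- x)\<close>.\<close>

lemma exp_le_quadratic:
  fixes x :: real
  assumes "\<bar>x\<bar> \<le> 1"
  shows "exp x \<le> 1 + x + x\<^sup>2"
proof (cases "x \<ge> 0")
  case True
  with assms show ?thesis by (intro exp_bound) auto
next
  case False
  have "1 \<le> 1 - x ^ 3"
    using False by (simp add: power3_eq_cube mult_nonneg_nonpos mult_nonpos_nonpos zero_le_mult_iff mult_le_0_iff)
  also have "\<dots> = (1 + x + x\<^sup>2) * (1 - x)"
    by (simp add: algebra_simps power2_eq_square power3_eq_cube)
  also have "\<dots> \<le> (1 + x + x\<^sup>2) * exp (- x)"
  proof (rule mult_left_mono)
    show "1 - x \<le> exp (- x)" using exp_ge_add_one_self[of "-x"] by simp
    have "0 \<le> 1 + x" "0 \<le> x\<^sup>2" using assms by auto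
    then show "0 \<le> 1 + x + x\<^sup>2" by linarith
  qed
  finally show ?thesis by (simp add: exp_minus field_simps)
qed

text \<open>Independence of the coordinates: the sum over \<open>y\<close> factorises for fixed
  \<open>x\<close>, and then the sum over \<open>x\<close> does.\<close>

lemma sum_PiE_pairs_prod:
  fixes g :: "'a \<Rightarrow> 'a \<Rightarrow> real"
  assumes "finite D" "finite I"
  shows "(\<Sum>x\<in>PiE D (\<lambda>_. I). \<Sum>y\<in>PiE D (\<lambda>_. I). \<Prod>i\<in>D. g (x i) (y i))
    = (\<Sum>a\<in>I. \<Sum>b\<in>I. g a b) ^ card D"
proof -
  have "(\<Sum>y\<in>PiE D (\<lambda>_. I). \<Prod>i\<in>D. g (x i) (y i)) = (\<Prod>i\<in>D. \<Sum>b\<in>I. g (x i) b)" for x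
    using prod_sum_PiE[of D "\<lambda>_. I" "\<lambda>i. g (x i)"] assms by simp
  then show ?thesis
    using prod_sum_PiE[of D "\<lambda>_. I" "\<lambda>i a. \<Sum>b\<in>I. g a b"] assms by simp
qed

text \<open>The exponential moment method, with counting in place of probability. Independence
  reduces the moment to one coordinate, where \<open>mean\<close> removes the linear term and leaves
  a factor \<open>exp ((l * M)^2)\<close>.\<close>

lemma chernoff_PiE_pairs:
  fixes f :: "'a \<Rightarrow> 'a \<Rightarrow> real"
  assumes fin: "finite D" "finite I"
    and mean: "(\<Sum>a\<in>I. \<Sum>b\<in>I. f a b) = 0"
    and bound: "\<And>a b. a \<in> I \<Longrightarrow> b \<in> I \<Longrightarrow> \<bar>f a b\<bar> \<le> M"
    and l: "0 \<le> l" "l * M \<le> 1"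
  shows "real (card {(x, y) \<in> PiE D (\<lambda>_. I) \<times> PiE D (\<lambda>_. I). w < (\<Sum>i\<in>D. f (x i) (y i))})
    \<le> real (card I) ^ (2 * card D) * exp (real (card D) * (l * M)\<^sup>2 - l * w)"
    (is "real (card ?S) \<le> _")
proof -
  let ?X = "PiE D (\<lambda>_. I)"
  have finX: "finite (?X \<times> ?X)" using fin by (simp add: finite_PiE)
  have coord: "(\<Sum>a\<in>I. \<Sum>b\<in>I. exp (l * f a b)) \<le> (real (card I))\<^sup>2 * exp ((l * M)\<^sup>2)"
  proof -
    have "exp (l * f a b) \<le> 1 + l * f a b + (l * M)\<^sup>2" if "a \<in> I" "b \<in> I" for a b
    proof -
      have "\<bar>l * f a b\<bar> \<le> l * M"
        using bound[OF that] l by (simp add: abs_mult mult_left_mono)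
      moreover from this have "(l * f a b)\<^sup>2 \<le> (l * M)\<^sup>2"
        by (metis abs_ge_zero power2_abs power_mono)
      ultimately show ?thesis using exp_le_quadratic[of "l * f a b"] l by linarith
    qed
    then have "(\<Sum>a\<in>I. \<Sum>b\<in>I. exp (l * f a b)) \<le> (\<Sum>a\<in>I. \<Sum>b\<in>I. 1 + l * f a b + (l * M)\<^sup>2)"
      by (intro sum_mono) auto
    also have "\<dots> = (real (card I))\<^sup>2 * (1 + (l * M)\<^sup>2) + l * (\<Sum>a\<in>I. \<Sum>b\<in>I. f a b)"
      by (simp add: sum.distrib sum_distrib_left power2_eq_square algebra_simps)
    also have "\<dots> \<le> (real (card I))\<^sup>2 * exp ((l * M)\<^sup>2)"
      using mean by (intro order_trans[OF eq_refl mult_left_mono[OF exp_ge_add_one_self]]) auto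
    finally show ?thesis .
  qed
  have "real (card ?S) = (\<Sum>p\<in>?S. 1)" by simp
  also have "\<dots> \<le> (\<Sum>(x, y)\<in>?S. exp (l * ((\<Sum>i\<in>D. f (x i) (y i)) - w)))"
    using l by (intro sum_mono) auto
  also have "\<dots> \<le> (\<Sum>(x, y)\<in>?X \<times> ?X. exp (l * ((\<Sum>i\<in>D. f (x i) (y i)) - w)))"
    using finX by (intro sum_mono2) auto
  also have "\<dots> = exp (- l * w) * (\<Sum>x\<in>?X. \<Sum>y\<in>?X. \<Prod>i\<in>D. exp (l * f (x i) (y i)))"
    using fin by (simp add: sum.cartesian_product[symmetric] sum_distrib_left exp_sum[symmetric]
        exp_add[symmetric] algebra_simps)
  also have "\<dots> = exp (- l * w) * (\<Sum>a\<in>I. \<Sum>b\<in>I. exp (l * f a b)) ^ card D"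
    using fin by (subst sum_PiE_pairs_prod[where g = "\<lambda>a b. exp (l * f a b)"]) auto
  also have "\<dots> \<le> exp (- l * w) * ((real (card I))\<^sup>2 * exp ((l * M)\<^sup>2)) ^ card D"
    using coord by (intro mult_left_mono power_mono) (auto intro!: sum_nonneg)
  also have "\<dots> = real (card I) ^ (2 * card D) * exp (real (card D) * (l * M)\<^sup>2 - l * w)"
    by (simp add: power_mult_distrib power_mult[symmetric] exp_of_nat_mult[symmetric] exp_diff exp_minus divide_inverse mult_ac)
  finally show ?thesis .
qed

lemma sum_half_power_abs_symmetric:
  "(\<Sum>k\<in>{- int N..int N}. (1/2::real) ^ nat \<bar>k\<bar>) = 3 - 2 * (1/2) ^ N"
proof (induction N)
  case 0
  show ?case by simp
next
  case (Suc N)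
  have "{- int (Suc N)..int (Suc N)} = insert (int N + 1) (insert (- int N - 1) {- int N..int N})"
    by auto
  moreover have "nat \<bar>int N + 1\<bar> = Suc N" "nat \<bar>- int N - 1\<bar> = Suc N" by auto
  ultimately show ?case using Suc by simp
qed

text \<open>The square of an integer is at least its absolute value, so after a shift by
  \<open>u\<close> the sum is dominated by the two-sided geometric series, whose value is 3.\<close>

lemma sum_half_power_square_le:
  assumes "finite (J :: int set)"
  shows "(\<Sum>k\<in>J. (1/2::real) ^ nat ((k - u)\<^sup>2)) \<le> 3"
proof -
  obtain N where N: "\<And>k. k \<in> J \<Longrightarrow> \<bar>k - u\<bar> \<le> int N"
  proof -
    have "bdd_above ((\<lambda>k. \<bar>k - u\<bar>) ` J)" using assms by (intro bdd_above_finite) auto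
    then obtain b where "\<And>k. k \<in> J \<Longrightarrow> \<bar>k - u\<bar> \<le> b" unfolding bdd_above_def by auto
    then show ?thesis by (intro that[of "nat b"]) force
  qed
  have "(\<Sum>k\<in>J. (1/2::real) ^ nat ((k - u)\<^sup>2)) \<le> (\<Sum>k\<in>J. (1/2) ^ nat \<bar>k - u\<bar>)"
  proof (intro sum_mono power_decreasing nat_mono)
    fix k
    have "\<bar>k - u\<bar> * 1 \<le> \<bar>k - u\<bar> * \<bar>k - u\<bar>" by (cases "k = u") (simp, intro mult_left_mono, auto)
    then show "\<bar>k - u\<bar> \<le> (k - u)\<^sup>2" by (simp add: power2_eq_square)
  qed auto
  also have "\<dots> = (\<Sum>k\<in>(\<lambda>k. k - u) ` J. (1/2) ^ nat \<bar>k\<bar>)"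
    by (subst sum.reindex) (auto simp: inj_on_def)
  also have "\<dots> \<le> (\<Sum>k\<in>{- int N..int N}. (1/2) ^ nat \<bar>k\<bar>)"
    using N by (intro sum_mono2) (auto simp: abs_le_iff; smt (verit))+
  also have "\<dots> \<le> 3" by (simp add: sum_half_power_abs_symmetric)
  finally show ?thesis .
qed

text \<open>Give \<open>s\<close> the weight \<open>4 ^ card D\<close> times \<open>1/2\<close> to
  the power of the squared distance. It is at least 1 on the ball and factorises, and each
  coordinate contributes at most \<open>4 * 3 = 12\<close>.\<close>

lemma card_lattice_ball_le:
  fixes u :: "'a \<Rightarrow> int"
  assumes fin: "finite D" "finite J"
  shows "card {s \<in> PiE D (\<lambda>_. J). (\<Sum>i\<in>D. (s i - u i)\<^sup>2) \<le> 2 * int (card D)} \<le> 12 ^ card D"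
    (is "card ?S \<le> _")
proof -
  have "real (card ?S) = (\<Sum>s\<in>?S. 1)" by simp
  also have "\<dots> \<le> (\<Sum>s\<in>?S. \<Prod>i\<in>D. 4 * (1/2) ^ nat ((s i - u i)\<^sup>2))"
  proof (rule sum_mono)
    fix s assume "s \<in> ?S"
    then have "int (\<Sum>i\<in>D. nat ((s i - u i)\<^sup>2)) \<le> int (2 * card D)" by simp
    then have "(\<Sum>i\<in>D. nat ((s i - u i)\<^sup>2)) \<le> 2 * card D" by linarith
    then have "(1/2::real) ^ (2 * card D) \<le> (1/2) ^ (\<Sum>i\<in>D. nat ((s i - u i)\<^sup>2))"
      by (intro power_decreasing) auto
    then have "4 ^ card D * (1/2::real) ^ (2 * card D) \<le> 4 ^ card D * (1/2) ^ (\<Sum>i\<in>D. nat ((s i - u i)\<^sup>2))"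
      by (intro mult_left_mono) auto
    moreover have "4 ^ card D * (1/2::real) ^ (2 * card D) = 1"
      unfolding power_mult power_mult_distrib[symmetric] by (simp add: power2_eq_square)
    moreover have "(\<Prod>i\<in>D. 4 * (1/2::real) ^ nat ((s i - u i)\<^sup>2))
        = 4 ^ card D * (1/2) ^ (\<Sum>i\<in>D. nat ((s i - u i)\<^sup>2))"
      unfolding power_sum prod.distrib by simp
    ultimately show "(1::real) \<le> (\<Prod>i\<in>D. 4 * (1/2) ^ nat ((s i - u i)\<^sup>2))"
      by (simp only:)
  qed
  also have "\<dots> \<le> (\<Sum>s\<in>PiE D (\<lambda>_. J). \<Prod>i\<in>D. 4 * (1/2) ^ nat ((s i - u i)\<^sup>2))"
    using fin by (intro sum_mono2) (auto intro!: finite_PiE prod_nonneg)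
  also have "\<dots> = (\<Prod>i\<in>D. 4 * (\<Sum>k\<in>J. (1/2) ^ nat ((k - u i)\<^sup>2)))"
    using prod_sum_PiE[of D "\<lambda>_. J" "\<lambda>i k. 4 * (1/2::real) ^ nat ((k - u i)\<^sup>2)"] fin
    by (simp add: sum_distrib_left)
  also have "\<dots> \<le> (\<Prod>i\<in>D. 12)"
    using sum_half_power_square_le[OF fin(2)]
    by (intro prod_mono) (auto intro!: sum_nonneg)
  finally have "real (card ?S) \<le> real (12 ^ card D)" by simp
  then show ?thesis unfolding of_nat_le_iff .
qed

section \<open>Typical pairs of lattice points\<close>

text \<open>The multiple of 3 nearest to \<open>x + y\<close>: adding 1 turns the floor into
  rounding. Among the numbers below \<open>2 * r\<close> there are about \<open>2 * r / 3\<close>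
  multiples of 3, fewer than \<open>r\<close>, whereas multiples of 2 would save nothing.\<close>

definition round3 :: "int \<Rightarrow> int \<Rightarrow> int" where
  "round3 x y = 3 * ((x + y + 1) div 3)"

lemma round3_error: "\<bar>round3 x y - x - y\<bar> \<le> 1"
proof -
  have "round3 x y = x + y + 1 - (x + y + 1) mod 3"
    by (simp add: round3_def minus_mod_eq_mult_div)
  moreover have "0 \<le> (x + y + 1) mod 3" "(x + y + 1) mod 3 < 3" by simp_all
  ultimately show ?thesis by linarith
qed

lemma round3_commute: "round3 x y = round3 y x"
  by (simp add: round3_def add.commute)

lemma round3_bounds:
  assumes "x \<in> {0..<int r}" "y \<in> {0..<int r}"
  shows "round3 x y \<in> {0..<2 * int r}"
proof -
  have "0 \<le> round3 x y"
    using assms unfolding round3_def by (simp add: pos_imp_zdiv_nonneg_iff)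
  then show ?thesis using round3_error[of x y] assms by auto
qed

text \<open>Equal to \<open>(r^2 - 1) / 6\<close> for positive \<open>r\<close>, but only its role
  as centring constant and the bounds 0 and \<open>r^2\<close> matter.\<close>

definition mean_sqdist :: "nat \<Rightarrow> real" where
  "mean_sqdist r = (\<Sum>x\<in>{0..<int r}. \<Sum>y\<in>{0..<int r}. (real_of_int (x - y))\<^sup>2) / (real r)\<^sup>2"

lemma sqdist_box_bound:
  assumes "x \<in> {0..<int r}" "y \<in> {0..<int r}"
  shows "(real_of_int (x - y))\<^sup>2 \<le> (real r)\<^sup>2"
proof -
  have "\<bar>real_of_int (x - y)\<bar> \<le> real r" using assms by auto
  then show ?thesis by (metis abs_ge_zero power2_abs power_mono)
qed

lemma mean_sqdist_bounds: "0 \<le> mean_sqdist r" "mean_sqdist r \<le> (real r)\<^sup>2"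
proof -
  show "0 \<le> mean_sqdist r"
    unfolding mean_sqdist_def by (intro divide_nonneg_nonneg sum_nonneg) auto
  have "(\<Sum>x\<in>{0..<int r}. \<Sum>y\<in>{0..<int r}. (real_of_int (x - y))\<^sup>2)
      \<le> (\<Sum>x\<in>{0..<int r}. \<Sum>y\<in>{0..<int r}. (real r)\<^sup>2)"
    by (intro sum_mono sqdist_box_bound)
  also have "\<dots> = (real r)\<^sup>2 * (real r)\<^sup>2" by (simp add: power2_eq_square)
  finally show "mean_sqdist r \<le> (real r)\<^sup>2"
    unfolding mean_sqdist_def by (cases "r = 0") (auto simp: divide_le_eq)
qed

lemma sum_sqdist_minus_mean:
  "(\<Sum>x\<in>{0..<int r}. \<Sum>y\<in>{0..<int r}. (real_of_int (x - y))\<^sup>2 - mean_sqdist r) = 0"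
  by (cases "r = 0") (auto simp: mean_sqdist_def sum_subtractf power2_eq_square)

text \<open>Exchanging \<open>x\<close> and \<open>y\<close> negates the first factor and fixes the
  rounding error, so the sum is its own negative. This removes the cross term from the mean squared
  distance of the rounded sum to \<open>2 * x\<close>.\<close>

lemma sum_antisymmetric_round3:
  "(\<Sum>x\<in>{0..<int r}. \<Sum>y\<in>{0..<int r}. real_of_int ((x - y) * (round3 x y - x - y))) = 0"
    (is "?S = 0")
proof -
  have "?S = (\<Sum>y\<in>{0..<int r}. \<Sum>x\<in>{0..<int r}. real_of_int ((x - y) * (round3 x y - x - y)))"
    by (rule sum.swap)
  also have "\<dots> = - ?S"
    unfolding sum_negf[symmetric]
    by (intro sum.cong refl) (subst round3_commute, simp add: algebra_simps)
  finally show ?thesis by simp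
qed

text \<open>The restriction to \<open>{..<d}\<close> makes the function extensional, as membership
  in \<open>coarse_box r d\<close> requires.\<close>

definition rounded_sum :: "nat \<Rightarrow> (nat \<Rightarrow> int) \<Rightarrow> (nat \<Rightarrow> int) \<Rightarrow> nat \<Rightarrow> int" where
  "rounded_sum d x y = (\<lambda>i\<in>{..<d}. round3 (x i) (y i))"

text \<open>The third vertex \<open>s\<close> stands for the point \<open>s / 2\<close>, hence the comparison of \<open>s\<close> with \<open>2 x\<close>.\<close>

definition typical_pair :: "nat \<Rightarrow> nat \<Rightarrow> (nat \<Rightarrow> int) \<Rightarrow> (nat \<Rightarrow> int) \<Rightarrow> bool" where
  "typical_pair r d x y \<longleftrightarrow>
    real d * mean_sqdist r - real d / 2 \<le> real_of_int (\<Sum>i<d. (x i - y i)\<^sup>2) \<and>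
    real_of_int (\<Sum>i<d. (rounded_sum d x y i - 2 * x i)\<^sup>2) \<le> real d * mean_sqdist r + 3 * real d / 2 \<and>
    real_of_int (\<Sum>i<d. (rounded_sum d x y i - 2 * y i)\<^sup>2) \<le> real d * mean_sqdist r + 3 * real d / 2"

abbreviation box :: "nat \<Rightarrow> nat \<Rightarrow> (nat \<Rightarrow> int) set" where
  "box r d \<equiv> PiE {..<d} (\<lambda>_. {0..<int r})"

abbreviation coarse_box :: "nat \<Rightarrow> nat \<Rightarrow> (nat \<Rightarrow> int) set" where
  "coarse_box r d \<equiv> PiE {..<d} (\<lambda>_. {k \<in> {0..<2 * int r}. 3 dvd k})"

lemma rounded_sum_in_coarse_box:
  assumes "x \<in> box r d" "y \<in> box r d"
  shows "rounded_sum d x y \<in> coarse_box r d"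
proof -
  have "x i \<in> {0..<int r}" "y i \<in> {0..<int r}" if "i < d" for i
    using assms that by blast+
  then have "round3 (x i) (y i) \<in> {0..<2 * int r}" if "i < d" for i
    using round3_bounds that by blast
  then show ?thesis
    by (auto simp: rounded_sum_def round3_def)
qed

lemma card_box: "card (box r d) = r ^ d"
  by (subst card_PiE) auto

text \<open>Each coordinate has at most \<open>(2 * r + 2) / 3\<close> values, and this is at most
  \<open>3 / 4 * r\<close> precisely from \<open>r = 8\<close> on.\<close>

lemma card_coarse_box_le:
  assumes "8 \<le> r"
  shows "real (card (coarse_box r d)) \<le> (3 / 4 * real r) ^ d"
proof -
  have "k \<in> (*) 3 ` {0..(2 * int r - 1) div 3}" if "0 \<le> k" "k < 2 * int r" "3 dvd k" for k
  proof
    show "k = 3 * (k div 3)" using that(3) by simp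
    have "0 \<le> k div 3" "k div 3 \<le> (2 * int r - 1) div 3" using that(1,2)
      by (simp_all add: pos_imp_zdiv_nonneg_iff zdiv_mono1)
    then show "k div 3 \<in> {0..(2 * int r - 1) div 3}" by simp
  qed
  then have "{k \<in> {0..<2 * int r}. 3 dvd k} \<subseteq> (*) 3 ` {0..(2 * int r - 1) div 3}"
    by auto
  then have "card {k \<in> {0..<2 * int r}. 3 dvd k} \<le> card {0..(2 * int r - 1) div 3}"
    by (meson finite_atLeastAtMost_int surj_card_le)
  moreover have "4 * nat ((2 * int r - 1) div 3 + 1) \<le> 3 * r"
  proof -
    have "3 * ((2 * int r - 1) div 3) \<le> 2 * int r - 1"
      using minus_mod_eq_mult_div[of "2 * int r - 1" 3] pos_mod_sign[of 3 "2 * int r - 1"] by linarith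
    then show ?thesis using assms by linarith
  qed
  ultimately have "4 * card {k \<in> {0..<2 * int r}. 3 dvd k} \<le> 3 * r"
    unfolding card_atLeastAtMost_int by linarith
  then have "real (card {k \<in> {0..<2 * int r}. 3 dvd k}) \<le> 3 / 4 * real r" by linarith
  moreover have "card (coarse_box r d) = card {k \<in> {0..<2 * int r}. 3 dvd k} ^ d"
    by (subst card_PiE) auto
  ultimately show ?thesis
    by (metis of_nat_0_le_iff of_nat_power power_mono)
qed

text \<open>The parallelogram law
  \<open>|s - 2x|^2 + |s - 2y|^2 = 2 |s - x - y|^2 + 2 |x - y|^2\<close>: the terms in
  \<open>m\<close> cancel, and the slacks add up to \<open>4 * d\<close>, which bounds twice the sum
  in question. Here \<open>s\<close> is arbitrary and need not be the rounded sum of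
  \<open>x\<close> and \<open>y\<close>.\<close>

lemma sum_sq_round_error_le:
  assumes "real d * m - real d / 2 \<le> real_of_int (\<Sum>i<d. (x i - y i)\<^sup>2)"
    and "real_of_int (\<Sum>i<d. (s i - 2 * x i)\<^sup>2) \<le> real d * m + 3 * real d / 2"
    and "real_of_int (\<Sum>i<d. (s i - 2 * y i)\<^sup>2) \<le> real d * m + 3 * real d / 2"
  shows "(\<Sum>i<d. (s i - (x i + y i))\<^sup>2) \<le> 2 * int d"
proof -
  let ?E = "\<Sum>i<d. (s i - (x i + y i))\<^sup>2" and ?Z = "\<Sum>i<d. (x i - y i)\<^sup>2"
    and ?X = "\<Sum>i<d. (s i - 2 * x i)\<^sup>2" and ?Y = "\<Sum>i<d. (s i - 2 * y i)\<^sup>2"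
  have sums: "2 * ?E = ?X + ?Y - 2 * ?Z"
    unfolding sum_distrib_left sum.distrib[symmetric] sum_subtractf[symmetric]
    by (intro sum.cong refl) (simp add: power2_eq_square algebra_simps)
  have "e \<le> 2 * int d" if "2 * e = x + y - 2 * z" "real d * m - real d / 2 \<le> real_of_int z"
    "real_of_int x \<le> real d * m + 3 * real d / 2" "real_of_int y \<le> real d * m + 3 * real d / 2" for e x y z :: int
    using that by linarith
  from this[OF sums assms] show ?thesis .
qed

text \<open>Each condition of typicality fails only through a one-sided deviation of a sum of
  independent centred terms. The factor 3 is the union bound.\<close>

lemma card_atypical_pairs_le:
  assumes "1 \<le> r"
  shows "real (card {(x, y) \<in> box r d \<times> box r d. \<not> typical_pair r d x y})
    \<le> 3 * real r ^ (2 * d) * exp (- real d / (64 * real r ^ 4))"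
proof -
  let ?I = "{0..<int r}"
  define m where "m = mean_sqdist r"
  \<comment> \<open>Up to the squared rounding error, \<open>f2\<close> and \<open>f3\<close> are
    the centred squares of \<open>round3 x y - 2 * x\<close> and \<open>round3 x y - 2 * y\<close>.
    Subtracting that error makes them sum to zero exactly, by antisymmetry of
    \<open>g\<close>.\<close>
  define f1 where "f1 x y = m - (real_of_int (x - y))\<^sup>2" for x y
  define g where "g x y = real_of_int ((x - y) * (round3 x y - x - y))" for x y
  define f2 where "f2 x y = (real_of_int (x - y))\<^sup>2 - m - 2 * g x y" for x y
  define f3 where "f3 x y = (real_of_int (x - y))\<^sup>2 - m + 2 * g x y" for x y
  define B where "B = 3 * real r ^ (2 * d) * exp (- real d / (64 * real r ^ 4))"
  define bad where "bad f = {(x, y) \<in> box r d \<times> box r d. real d / 2 < (\<Sum>i<d. f (x i) (y i))}"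
    for f :: "int \<Rightarrow> int \<Rightarrow> real"
  have tail: "real (card (bad f)) \<le> B / 3"
    if "(\<Sum>a\<in>?I. \<Sum>b\<in>?I. f a b) = 0"
      and bound: "\<And>a b. a \<in> ?I \<Longrightarrow> b \<in> ?I \<Longrightarrow> \<bar>f a b\<bar> \<le> (real r)\<^sup>2 + 1" for f
  proof -
    define M where "M = 2 * (real r)\<^sup>2"
    have "1 \<le> (real r)\<^sup>2" using assms by simp
    then have M: "2 \<le> M" "(real r)\<^sup>2 + 1 \<le> M"
      by (simp_all add: M_def)
    then have fM: "\<bar>f a b\<bar> \<le> M" if "a \<in> ?I" "b \<in> ?I" for a b
      using bound[OF that] by linarith
    \<comment> \<open>The choice \<open>l = 1 / (4 * M^2)\<close> minimises the exponent
      \<open>d * (l * M)^2 - l * d / 2\<close>.\<close>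
    have "real (card (bad f)) \<le> real r ^ (2 * d) *
        exp (real d * (1 / (4 * M\<^sup>2) * M)\<^sup>2 - 1 / (4 * M\<^sup>2) * (real d / 2))"
    proof -
      have "1 / (4 * M\<^sup>2) * M \<le> 1" "0 \<le> 1 / (4 * M\<^sup>2)"
        using M(1) by (simp_all add: power2_eq_square)
      from chernoff_PiE_pairs[OF _ _ that(1) fM this(2,1), of "{..<d}" "real d / 2"]
      show ?thesis unfolding bad_def by simp
    qed
    also have "real d * (1 / (4 * M\<^sup>2) * M)\<^sup>2 - 1 / (4 * M\<^sup>2) * (real d / 2) = - real d / (16 * M\<^sup>2)"
      using M(1) by (simp add: power2_eq_square field_simps)
    also have "16 * M\<^sup>2 = 64 * real r ^ 4"
      by (simp add: M_def power_mult_distrib power_mult[symmetric])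
    finally show ?thesis by (simp add: B_def)
  qed
  have m: "0 \<le> m" "m \<le> (real r)\<^sup>2" using mean_sqdist_bounds m_def by auto
  have sq: "0 \<le> (real_of_int (x - y))\<^sup>2" "(real_of_int (x - y))\<^sup>2 \<le> (real r)\<^sup>2"
    if "x \<in> ?I" "y \<in> ?I" for x y
    using sqdist_box_bound[OF that] by auto
  have sum_f1: "(\<Sum>a\<in>?I. \<Sum>b\<in>?I. f1 a b) = 0"
  proof -
    have "(\<Sum>a\<in>?I. \<Sum>b\<in>?I. f1 a b)
        = - (\<Sum>a\<in>?I. \<Sum>b\<in>?I. (real_of_int (a - b))\<^sup>2 - mean_sqdist r)"
      unfolding f1_def m_def sum_negf[symmetric] by simp
    then show ?thesis by (simp only: sum_sqdist_minus_mean)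
  qed
  have sum_f2: "(\<Sum>a\<in>?I. \<Sum>b\<in>?I. f2 a b) = 0"
  proof -
    have "(\<Sum>a\<in>?I. \<Sum>b\<in>?I. f2 a b)
        = (\<Sum>a\<in>?I. \<Sum>b\<in>?I. (real_of_int (a - b))\<^sup>2 - m) - 2 * (\<Sum>a\<in>?I. \<Sum>b\<in>?I. g a b)"
      unfolding f2_def sum_distrib_left sum_subtractf[symmetric] ..
    then show ?thesis
      unfolding m_def g_def sum_sqdist_minus_mean sum_antisymmetric_round3 by simp
  qed
  have sum_f3: "(\<Sum>a\<in>?I. \<Sum>b\<in>?I. f3 a b) = 0"
  proof -
    have "(\<Sum>a\<in>?I. \<Sum>b\<in>?I. f3 a b)
        = (\<Sum>a\<in>?I. \<Sum>b\<in>?I. (real_of_int (a - b))\<^sup>2 - m) + 2 * (\<Sum>a\<in>?I. \<Sum>b\<in>?I. g a b)"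
      unfolding f3_def sum_distrib_left sum.distrib[symmetric] ..
    then show ?thesis
      unfolding m_def g_def sum_sqdist_minus_mean sum_antisymmetric_round3 by simp
  qed
  \<comment> \<open>With \<open>e\<close> the rounding error, the squared terms are
    \<open>e - (x - y)\<close> and \<open>e + (x - y)\<close>, and \<open>g\<close> is the cross
    term.\<close>
  have expand: "(real_of_int (x - y))\<^sup>2 - 2 * g x y = (real_of_int (round3 x y - 2 * x))\<^sup>2
      - (real_of_int (round3 x y - x - y))\<^sup>2"
    "(real_of_int (x - y))\<^sup>2 + 2 * g x y = (real_of_int (round3 x y - 2 * y))\<^sup>2
      - (real_of_int (round3 x y - x - y))\<^sup>2" for x y
    unfolding g_def of_int_diff of_int_mult of_int_numeral by algebra+
  have err: "(real_of_int (round3 x y - x - y))\<^sup>2 \<le> 1" for x y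
  proof -
    have "\<bar>real_of_int (round3 x y - x - y)\<bar> \<le> 1" using round3_error[of x y] by linarith
    then show ?thesis by (rule abs_square_le_1[THEN iffD2])
  qed
  have dist: "(real_of_int (round3 x y - 2 * x))\<^sup>2 \<le> (real r)\<^sup>2"
    "(real_of_int (round3 x y - 2 * y))\<^sup>2 \<le> (real r)\<^sup>2" if "x \<in> ?I" "y \<in> ?I" for x y
  proof -
    have "\<bar>round3 x y - 2 * x\<bar> \<le> int r" "\<bar>round3 x y - 2 * y\<bar> \<le> int r"
      using round3_error[of x y] that by auto
    then have "\<bar>real_of_int (round3 x y - 2 * x)\<bar> \<le> real r" "\<bar>real_of_int (round3 x y - 2 * y)\<bar> \<le> real r"
      by linarith+
    then show "(real_of_int (round3 x y - 2 * x))\<^sup>2 \<le> (real r)\<^sup>2"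
      "(real_of_int (round3 x y - 2 * y))\<^sup>2 \<le> (real r)\<^sup>2"
      by (metis abs_ge_zero power2_abs power_mono)+
  qed
  have bd1: "\<bar>f1 x y\<bar> \<le> (real r)\<^sup>2 + 1" if "x \<in> ?I" "y \<in> ?I" for x y
    using sq[OF that] m unfolding f1_def by linarith
  have bd2: "\<bar>f2 x y\<bar> \<le> (real r)\<^sup>2 + 1" if "x \<in> ?I" "y \<in> ?I" for x y
  proof -
    have eq: "f2 x y = (real_of_int (round3 x y - 2 * x))\<^sup>2 - (real_of_int (round3 x y - x - y))\<^sup>2 - m"
      unfolding f2_def using expand(1)[of x y] by argo
    have "\<bar>a - b - m\<bar> \<le> R + 1" if "0 \<le> a" "a \<le> R" "0 \<le> b" "b \<le> 1" "m \<le> R" for a b R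
      using that m(1) by linarith
    then show ?thesis
      unfolding eq using dist(1)[OF that] m(2) err[of x y] by (meson zero_le_power2)
  qed
  have bd3: "\<bar>f3 x y\<bar> \<le> (real r)\<^sup>2 + 1" if "x \<in> ?I" "y \<in> ?I" for x y
  proof -
    have eq: "f3 x y = (real_of_int (round3 x y - 2 * y))\<^sup>2 - (real_of_int (round3 x y - x - y))\<^sup>2 - m"
      unfolding f3_def using expand(2)[of x y] by argo
    have "\<bar>a - b - m\<bar> \<le> R + 1" if "0 \<le> a" "a \<le> R" "0 \<le> b" "b \<le> 1" "m \<le> R" for a b R
      using that m(1) by linarith
    then show ?thesis
      unfolding eq using dist(2)[OF that] m(2) err[of x y] by (meson zero_le_power2)
  qed
  have "{(x, y) \<in> box r d \<times> box r d. \<not> typical_pair r d x y} \<subseteq> bad f1 \<union> bad f2 \<union> bad f3"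
  proof clarify
    fix x y
    assume xy: "x \<in> box r d" "y \<in> box r d" and "\<not> typical_pair r d x y"
      and "(x, y) \<notin> bad f3" "(x, y) \<notin> bad f2"
    have "(\<Sum>i<d. f1 (x i) (y i)) = real d * m - real_of_int (\<Sum>i<d. (x i - y i)\<^sup>2)"
      by (simp add: f1_def sum_subtractf)
    \<comment> \<open>The \<open>+ 1\<close> pays for the squared rounding error; over
      \<open>d\<close> coordinates it raises the slack from \<open>d / 2\<close> to the
      \<open>3 * d / 2\<close> of \<open>typical_pair\<close>.\<close>
    moreover have "real_of_int (\<Sum>i<d. (rounded_sum d x y i - 2 * x i)\<^sup>2)
        \<le> (\<Sum>i<d. f2 (x i) (y i) + m + 1)"
      unfolding of_int_sum
    proof (rule sum_mono)
      fix i assume "i \<in> {..<d}"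
      then show "real_of_int ((rounded_sum d x y i - 2 * x i)\<^sup>2) \<le> f2 (x i) (y i) + m + 1"
        using expand(1)[of "x i" "y i"] err[of "x i" "y i"]
        unfolding f2_def by (simp add: rounded_sum_def)
    qed
    moreover have "real_of_int (\<Sum>i<d. (rounded_sum d x y i - 2 * y i)\<^sup>2)
        \<le> (\<Sum>i<d. f3 (x i) (y i) + m + 1)"
      unfolding of_int_sum
    proof (rule sum_mono)
      fix i assume "i \<in> {..<d}"
      then show "real_of_int ((rounded_sum d x y i - 2 * y i)\<^sup>2) \<le> f3 (x i) (y i) + m + 1"
        using expand(2)[of "x i" "y i"] err[of "x i" "y i"]
        unfolding f3_def by (simp add: rounded_sum_def)
    qed
    moreover have "(\<Sum>i<d. f (x i) (y i) + m + 1) \<le> real d * m + 3 * real d / 2"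
      if "(x, y) \<notin> bad f" for f
      using that xy unfolding bad_def by (simp add: sum.distrib)
    ultimately have "\<not> (\<Sum>i<d. f1 (x i) (y i)) \<le> real d / 2"
      using \<open>\<not> typical_pair r d x y\<close> \<open>(x, y) \<notin> bad f3\<close> \<open>(x, y) \<notin> bad f2\<close>
      unfolding typical_pair_def m_def[symmetric] by fastforce
    then show "(x, y) \<in> bad f1"
      using xy unfolding bad_def by simp
  qed
  moreover have fin: "finite (bad f)" for f
    unfolding bad_def by (rule finite_subset[of _ "box r d \<times> box r d"]) (auto intro!: finite_PiE)
  ultimately have "card {(x, y) \<in> box r d \<times> box r d. \<not> typical_pair r d x y}
      \<le> card (bad f1 \<union> bad f2 \<union> bad f3)"
    by (intro card_mono) auto
  also have "\<dots> \<le> card (bad f1) + card (bad f2) + card (bad f3)"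
    by (meson add_le_mono card_Un_le le_refl order_trans)
  finally show ?thesis
    using tail[OF sum_f1 bd1] tail[OF sum_f2 bd2] tail[OF sum_f3 bd3] unfolding B_def by linarith
qed

text \<open>\<open>A\<close> and \<open>B\<close> are embedded in the box and \<open>C\<close> is a
  copy of \<open>coarse_box r d\<close>. In any triangle, with points \<open>x\<close>,
  \<open>y\<close> and \<open>s\<close>, the vector \<open>s - x - y\<close> has squared length at
  most \<open>2 * d\<close>, so two of the points confine the third to a ball.\<close>

lemma lattice_triangle_graph:
  assumes r: "8 \<le> r" and n: "n \<le> r ^ d" and c: "card (coarse_box r d) \<le> n"
  shows "\<exists>(V::nat set) E. finite V \<and> card V = n \<and> simple_graph V E \<and>
    (real ((n - card (coarse_box r d)) div 2))\<^sup>2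
      - 3 * real r ^ (2 * d) * exp (- real d / (64 * real r ^ 4)) \<le> real (card E) \<and>
    (\<forall>e\<in>E. 1 \<le> card (triangles_containing V E e) \<and> card (triangles_containing V E e) \<le> 12 ^ d)"
proof -
  let ?X = "box r d" and ?S = "coarse_box r d"
  \<comment> \<open>What \<open>C\<close> leaves is halved, with at most one vertex outside the
    three classes. By \<open>n \<le> r ^ d\<close> each half fits into the box.\<close>
  define M where "M = (n - card ?S) div 2"
  define A B C where "A = {..<M}" and "B = {M..<2 * M}" and "C = {2 * M..<2 * M + card ?S}"
  have "M \<le> r ^ d"
    using n unfolding M_def by (meson diff_le_self div_le_dividend order_trans)
  have "2 * ((n - k) div 2) + k \<le> n" if "k \<le> n" for k
    using that by presburger
  then have "2 * M + card ?S \<le> n"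
    using c unfolding M_def by blast
  have finJ: "finite {k \<in> {0..<2 * int r}. 3 dvd k}" by (rule finite_subset[of _ "{0..<2 * int r}"]) auto
  then have fin: "finite ?S" "finite ?X"
    using finite_PiE[of "{..<d}" "\<lambda>_. {0..<int r}"] finite_PiE[of "{..<d}" "\<lambda>_. {k \<in> {0..<2 * int r}. 3 dvd k}"]
    by blast+
  have "card A \<le> card ?X" "card B \<le> card ?X"
    using \<open>M \<le> r ^ d\<close> unfolding card_box A_def B_def by simp_all
  then obtain u v where u: "u ` A \<subseteq> ?X" "inj_on u A" and v: "v ` B \<subseteq> ?X" "inj_on v B"
    using card_le_inj[of A ?X] card_le_inj[of B ?X] fin(2) unfolding A_def B_def
    by (metis finite_atLeastLessThan finite_lessThan)
  have "card ?S = card C" "finite C"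
    unfolding C_def by (simp_all only: card_atLeastLessThan diff_add_inverse finite_atLeastLessThan)
  then obtain w where w: "bij_betw w ?S C"
    using finite_same_card_bij[OF fin(1)] by blast
  define P where "P = {(a, b) \<in> A \<times> B. typical_pair r d (u a) (v b)}"
  define t where "t a b = w (rounded_sum d (u a) (v b))" for a b
  define m where "m = mean_sqdist r"
  let ?Q = "(\<lambda>(a, b). (a, t a b)) ` P" and ?R = "(\<lambda>(a, b). (b, t a b)) ` P"
  \<comment> \<open>This is what an edge into \<open>C\<close> retains once the pair that generated
    it is forgotten.\<close>
  define close where "close s x \<longleftrightarrow>
    real_of_int (\<Sum>i<d. (s i - 2 * x i)\<^sup>2) \<le> real d * m + 3 * real d / 2" for s x :: "nat \<Rightarrow> int"
  have P: "a \<in> A" "b \<in> B" "u a \<in> ?X" "v b \<in> ?X"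
    "real d * m - real d / 2 \<le> real_of_int (\<Sum>i<d. (u a i - v b i)\<^sup>2)"
    "rounded_sum d (u a) (v b) \<in> ?S"
    "close (rounded_sum d (u a) (v b)) (u a)" "close (rounded_sum d (u a) (v b)) (v b)"
    if "(a, b) \<in> P" for a b
  proof -
    show ab: "a \<in> A" "b \<in> B" using that unfolding P_def by simp_all
    then show X: "u a \<in> ?X" "v b \<in> ?X" using u(1) v(1) by blast+
    then show "rounded_sum d (u a) (v b) \<in> ?S" by (rule rounded_sum_in_coarse_box)
    have "typical_pair r d (u a) (v b)" using that unfolding P_def by simp
    then show "real d * m - real d / 2 \<le> real_of_int (\<Sum>i<d. (u a i - v b i)\<^sup>2)"
      "close (rounded_sum d (u a) (v b)) (u a)" "close (rounded_sum d (u a) (v b)) (v b)"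
      unfolding typical_pair_def close_def m_def by blast+
  qed
  have Q: "\<exists>s\<in>?S. z = w s \<and> close s (u a)" if z: "(a, z) \<in> ?Q" for a z
  proof -
    obtain b where "(a, b) \<in> P" "z = t a b" using z by auto
    then show ?thesis using P(6,7)[of a b] unfolding t_def by blast
  qed
  have R: "\<exists>s\<in>?S. z = w s \<and> close s (v b)" if z: "(b, z) \<in> ?R" for b z
  proof -
    obtain a where "(a, b) \<in> P" "z = t a b" using z by auto
    then show ?thesis using P(6,8)[of a b] unfolding t_def by blast
  qed
  have w_inj: "s = s'" if "w s = w s'" "s \<in> ?S" "s' \<in> ?S" for s s'
    using w that by (meson bij_betw_def inj_onD)
  have Q_close: "close s (u a)" if "(a, w s) \<in> ?Q" "s \<in> ?S" for a s
    using Q[OF that(1)] w_inj[OF _ that(2)] by blast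
  have R_close: "close s (v b)" if "(b, w s) \<in> ?R" "s \<in> ?S" for b s
    using R[OF that(1)] w_inj[OF _ that(2)] by blast
  \<comment> \<open>This covers triangles whose edges stem from three different pairs:
    \<open>s\<close> need only be close to both points.\<close>
  have error: "(\<Sum>i<d. (s i - (u a i + v b i))\<^sup>2) \<le> 2 * int d"
    if "(a, b) \<in> P" "close s (u a)" "close s (v b)" for a b s
    using that(2,3) unfolding close_def by (rule sum_sq_round_error_le[OF P(5)[OF that(1)]])
  have ball: "card {s \<in> PiE {..<d} (\<lambda>_. J). (\<Sum>i<d. (s i - p i)\<^sup>2) \<le> 2 * int d} \<le> 12 ^ d"
    if "finite J" for J p
    using card_lattice_ball_le[of "{..<d}" J p] that by simp
  have finball: "finite {s \<in> PiE {..<d} (\<lambda>_. J). (\<Sum>i<d. (s i - p i)\<^sup>2) \<le> 2 * int d}"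
    if "finite J" for J and p :: "nat \<Rightarrow> int"
    using that by (auto intro!: finite_PiE)
  have "\<exists>E. simple_graph {..<n} E \<and> card P \<le> card E \<and> (\<forall>e\<in>E.
      1 \<le> card (triangles_containing {..<n} E e) \<and> card (triangles_containing {..<n} E e) \<le> 12 ^ d)"
  proof (rule tripartite_triangle_graph[where A = A and B = B and C = C and t = t])
    show "A \<subseteq> {..<n}" "B \<subseteq> {..<n}" "C \<subseteq> {..<n}" "A \<inter> B = {}" "A \<inter> C = {}" "B \<inter> C = {}"
      using \<open>2 * M + card ?S \<le> n\<close> unfolding A_def B_def C_def by auto
    show "P \<subseteq> A \<times> B" unfolding P_def by auto
    show "t a b \<in> C" if "(a, b) \<in> P" for a b
      using P(6)[OF that] w unfolding t_def by (auto simp: bij_betw_def)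
  next
    fix a b assume ab: "(a, b) \<in> P"
    let ?Z = "{s \<in> ?S. (\<Sum>i<d. (s i - (u a i + v b i))\<^sup>2) \<le> 2 * int d}"
    have "{z. (a, z) \<in> ?Q \<and> (b, z) \<in> ?R} \<subseteq> w ` ?Z"
    proof (rule subsetI, drule CollectD, erule conjE)
      fix z assume z: "(a, z) \<in> ?Q" "(b, z) \<in> ?R"
      obtain s where s: "s \<in> ?S" "z = w s" using Q[OF z(1)] by blast
      have "s \<in> ?Z"
        using s(1) error[OF ab Q_close[OF z(1)[unfolded s(2)] s(1)] R_close[OF z(2)[unfolded s(2)] s(1)]] by simp
      then show "z \<in> w ` ?Z" using s(2) by blast
    qed
    then have "card {z. (a, z) \<in> ?Q \<and> (b, z) \<in> ?R} \<le> card ?Z"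
      by (rule surj_card_le[rotated]) (rule finball[OF finJ])
    also have "\<dots> \<le> 12 ^ d" by (rule ball[OF finJ])
    finally show "card {z. (a, z) \<in> ?Q \<and> (b, z) \<in> ?R} \<le> 12 ^ d" .
  next
    fix a z assume "(a, z) \<in> ?Q"
    then obtain s where s: "s \<in> ?S" "z = w s" "close s (u a)" using Q by blast
    \<comment> \<open>The same sum of squares, read with \<open>y\<close> unknown, is the squared
      distance from \<open>y\<close> to \<open>s - x\<close>; injectivity of \<open>v\<close>
      transfers the count to vertices.\<close>
    let ?Y = "{y \<in> ?X. (\<Sum>i<d. (y i - (s i - u a i))\<^sup>2) \<le> 2 * int d}"
    let ?N = "{b. (a, b) \<in> P \<and> (b, z) \<in> ?R}"
    have "v ` ?N \<subseteq> ?Y"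
    proof (rule image_subsetI, drule CollectD, erule conjE)
      fix b assume b: "(a, b) \<in> P" "(b, z) \<in> ?R"
      note error[OF b(1) s(3) R_close[OF b(2)[unfolded s(2)] s(1)]]
      moreover have "(v b i - (s i - u a i))\<^sup>2 = (s i - (u a i + v b i))\<^sup>2" for i
        by algebra
      ultimately show "v b \<in> ?Y"
        using P(4)[OF b(1)] by simp
    qed
    moreover have "inj_on v ?N"
      using v(2) by (rule inj_on_subset) (auto simp: P_def)
    ultimately have "card ?N \<le> card ?Y"
      by (intro card_inj_on_le finball) auto
    also have "\<dots> \<le> 12 ^ d" by (rule ball) simp
    finally show "card ?N \<le> 12 ^ d" .
  next
    fix b z assume "(b, z) \<in> ?R"
    then obtain s where s: "s \<in> ?S" "z = w s" "close s (v b)" using R by blast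
    let ?Y = "{x \<in> ?X. (\<Sum>i<d. (x i - (s i - v b i))\<^sup>2) \<le> 2 * int d}"
    let ?N = "{a. (a, b) \<in> P \<and> (a, z) \<in> ?Q}"
    have "u ` ?N \<subseteq> ?Y"
    proof (rule image_subsetI, drule CollectD, erule conjE)
      fix a assume a: "(a, b) \<in> P" "(a, z) \<in> ?Q"
      note error[OF a(1) Q_close[OF a(2)[unfolded s(2)] s(1)] s(3)]
      moreover have "(u a i - (s i - v b i))\<^sup>2 = (s i - (u a i + v b i))\<^sup>2" for i
        by algebra
      ultimately show "u a \<in> ?Y"
        using P(3)[OF a(1)] by simp
    qed
    moreover have "inj_on u ?N"
      using u(2) by (rule inj_on_subset) (auto simp: P_def)
    ultimately have "card ?N \<le> card ?Y"
      by (intro card_inj_on_le finball) auto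
    also have "\<dots> \<le> 12 ^ d" by (rule ball) simp
    finally show "card ?N \<le> 12 ^ d" .
  qed simp
  then obtain E where E: "simple_graph {..<n} E" "card P \<le> card E" "\<forall>e\<in>E.
      1 \<le> card (triangles_containing {..<n} E e) \<and> card (triangles_containing {..<n} E e) \<le> 12 ^ d"
    by blast
  have "(real M)\<^sup>2 - 3 * real r ^ (2 * d) * exp (- real d / (64 * real r ^ 4)) \<le> real (card P)"
  proof -
    \<comment> \<open>Missing edges between \<open>A\<close> and \<open>B\<close> inject into the
      atypical pairs of the full box, so the global count applies even if the halves fill only part
      of it.\<close>
    let ?bad = "{(x, y) \<in> ?X \<times> ?X. \<not> typical_pair r d x y}"
    have "finite ?bad" using fin by (auto intro: finite_subset[of _ "?X \<times> ?X"])
    moreover have "map_prod u v ` (A \<times> B - P) \<subseteq> ?bad"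
      using u(1) v(1) unfolding P_def by auto
    moreover have "inj_on (map_prod u v) (A \<times> B - P)"
      using map_prod_inj_on[OF u(2) v(2)] by (rule inj_on_subset) auto
    ultimately have "card (A \<times> B - P) \<le> card ?bad"
      by (meson card_inj_on_le)
    moreover have "card (A \<times> B - P) = M * M - card P"
    proof -
      have "finite (A \<times> B)" "P \<subseteq> A \<times> B" unfolding P_def A_def B_def by auto
      then show ?thesis by (simp add: card_Diff_subset finite_subset A_def B_def)
    qed
    ultimately have "M * M \<le> card ?bad + card P" by simp
    then have "real M * real M \<le> real (card ?bad) + real (card P)"
      unfolding of_nat_add[symmetric] of_nat_mult[symmetric] of_nat_le_iff .
    moreover have "1 \<le> r" using r by simp
    ultimately show ?thesis
      using card_atypical_pairs_le[of r d] unfolding power2_eq_square by linarith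
  qed
  also have "real (card P) \<le> real (card E)" using E(2) by simp
  finally show ?thesis
    unfolding M_def[symmetric] using E(1,3)
    by (intro exI[of _ "{..<n}"] exI[of _ E] conjI) simp_all
qed

section \<open>Choice of the parameters\<close>

text \<open>Any bound below \<open>14 / 5\<close> would do, since \<open>12 ^ d\<close> is about
  \<open>n\<close> to the power \<open>5 * ln 12 / ln L\<close> with \<open>L = ln n\<close>. Nine
  factors make the quadratic Taylor bound accurate enough.\<close>

lemma ln_12_le: "ln (12::real) \<le> 27 / 10"
proof -
  have "(12::real) \<le> (1 + 3/10 + (3/10)\<^sup>2 / 2) ^ 9" by (simp add: power2_eq_square power_divide)
  also have "\<dots> \<le> exp (3/10) ^ 9"
    by (intro power_mono exp_lower_Taylor_quadratic) auto
  also have "\<dots> = exp (27/10)" by (simp flip: exp_of_nat_mult)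
  finally have "ln (12::real) \<le> ln (exp (27/10))" by (subst ln_le_cancel_iff) auto
  then show ?thesis by simp
qed

text \<open>With \<open>L = ln n\<close>, \<open>L powr (1/5)\<close> bounds \<open>r\<close> from
  above and \<open>5 * L / ln L\<close> bounds \<open>d\<close> from below. The summands are the
  losses to the third class, to parity and to atypical pairs. The last is the largest: its exponent
  has order \<open>L powr (1/5) / ln L\<close>, which beats \<open>L powr (1/6)\<close>.\<close>

lemma eventually_edge_loss_le:
  "\<forall>\<^sub>F L::real in at_top. 2 * L powr (1/5) * (3/4) powr (5 * L / ln L) + 2 * exp (- L)
    + 12 * (L powr (1/5))\<^sup>2 * exp (- (5 * L / ln L) / (64 * (L powr (1/5)) ^ 4)) \<le> exp (- (L powr (1/6)))"
  by real_asymp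

text \<open>\<open>L powr (1/5) - 1\<close> is a lower bound for \<open>r\<close>. The left side
  grows like \<open>13.5 * L / ln L\<close>.\<close>

lemma eventually_codegree_exponent_le:
  "\<forall>\<^sub>F L::real in at_top. 27 / 10 * (L / ln (L powr (1/5) - 1) + 1) \<le> 14 / ln L * L"
  by real_asymp

lemma eventually_root5_ge:
  "\<forall>\<^sub>F L::real in at_top. 9 \<le> L powr (1/5)"
  by real_asymp

text \<open>Minimality makes \<open>r ^ d\<close> exceed \<open>n\<close> by less than a factor
  \<open>r\<close>; \<open>n \<ge> 2\<close> excludes \<open>d = 0\<close>, so \<open>d - 1\<close>
  is a true predecessor.\<close>

lemma least_power_exponent:
  fixes n r :: nat
  assumes "2 \<le> r" "2 \<le> n"
  obtains d where "1 \<le> d" "n \<le> r ^ d" "r ^ (d - 1) < n"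
proof -
  have "n \<le> r ^ n"
    using less_exp[of n] power_mono[OF assms(1), of n] by linarith
  define d where "d = (LEAST d. n \<le> r ^ d)"
  have d: "n \<le> r ^ d" unfolding d_def using \<open>n \<le> r ^ n\<close> by (rule LeastI)
  moreover have "d \<noteq> 0" using d assms(2) by (intro notI) simp
  moreover have "\<not> n \<le> r ^ (d - 1)"
    using \<open>d \<noteq> 0\<close> unfolding d_def by (intro not_less_Least) simp
  ultimately show ?thesis using that[of d] by simp
qed

text \<open>Relative to \<open>n^2 / 4\<close>, giving up a fraction \<open>y\<close> of the
  vertices costs at most \<open>2 * y\<close>, and the atypical pairs, at most
  \<open>3 * r^2 * n^2 * x\<close> in number, cost \<open>12 * r^2 * x\<close>.\<close>

lemma edge_count_lower_bound:
  fixes n c d r :: nat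
  assumes n: "1 \<le> n" and c: "real c \<le> (3 / 4 * real r) ^ d" and rd: "real r ^ d \<le> real r * real n"
    and loss: "2 * real r * (3/4) ^ d + 2 / real n + 12 * (real r)\<^sup>2 * x \<le> \<epsilon>"
    and x: "0 \<le> x" and "c \<le> n"
  shows "(real n)\<^sup>2 / 4 * (1 - \<epsilon>) \<le> (real ((n - c) div 2))\<^sup>2 - 3 * real r ^ (2 * d) * x"
proof -
  have "real c \<le> (3/4) ^ d * real r ^ d" using c by (simp add: power_mult_distrib power_divide)
  also have "\<dots> \<le> (3/4) ^ d * (real r * real n)" using rd by (intro mult_left_mono) auto
  finally have c': "real c + 1 \<le> real n * (real r * (3/4) ^ d + 1 / real n)"
    using n by (simp add: field_simps)
  define y where "y = real r * (3/4) ^ d + 1 / real n"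
  have y: "real c + 1 \<le> real n * y" "0 \<le> y" using c' unfolding y_def by simp_all
  have "n \<le> 2 * ((n - c) div 2) + c + 1" by presburger
  then have half: "real n - real c - 1 \<le> 2 * real ((n - c) div 2)" by linarith
  have "(real n)\<^sup>2 * (1 - 2 * y) \<le> 4 * (real ((n - c) div 2))\<^sup>2"
  \<comment> \<open>Squaring needs \<open>1 - y\<close> nonnegative; for larger \<open>y\<close> the
    left side of the claim is already at most 0.\<close>
  proof (cases "y \<le> 1")
    case True
    then have "0 \<le> real n * (1 - y)" by simp
    moreover have "real n * (1 - y) \<le> 2 * real ((n - c) div 2)"
      using half y(1) by (simp add: algebra_simps)
    ultimately have "(real n * (1 - y))\<^sup>2 \<le> (2 * real ((n - c) div 2))\<^sup>2"
      by (intro power_mono)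
    moreover have "(real n)\<^sup>2 * (1 - 2 * y) \<le> (real n)\<^sup>2 * (1 - y)\<^sup>2"
      by (intro mult_left_mono) (simp_all add: power2_eq_square algebra_simps)
    ultimately show ?thesis by (simp add: power_mult_distrib)
  next
    case False
    then have "(real n)\<^sup>2 * (1 - 2 * y) \<le> 0" by (intro mult_nonneg_nonpos) auto
    also have "0 \<le> 4 * (real ((n - c) div 2))\<^sup>2" by simp
    finally show ?thesis .
  qed
  moreover have "real r ^ (2 * d) * x \<le> (real r)\<^sup>2 * (real n)\<^sup>2 * x"
  proof (intro mult_right_mono x)
    have "(real r ^ d)\<^sup>2 \<le> (real r * real n)\<^sup>2" using rd by (intro power_mono) auto
    then show "real r ^ (2 * d) \<le> (real r)\<^sup>2 * (real n)\<^sup>2"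
      by (simp add: power_mult_distrib power_even_eq)
  qed
  moreover have "(real n)\<^sup>2 * (2 * y + 12 * (real r)\<^sup>2 * x) \<le> (real n)\<^sup>2 * \<epsilon>"
    using loss unfolding y_def by (intro mult_left_mono) (simp_all add: algebra_simps)
  ultimately have "(real n)\<^sup>2 * (1 - \<epsilon>) \<le> 4 * ((real ((n - c) div 2))\<^sup>2 - 3 * (real r ^ (2 * d) * x))"
    by (simp add: algebra_simps)
  then show ?thesis by simp
qed

lemma dense_graph_with_small_codegrees:
  fixes n :: nat
  defines "L \<equiv> ln (real n)"
  assumes n: "2 \<le> n" and L: "1 < L" and q: "9 \<le> L powr (1/5)"
    and loss: "2 * L powr (1/5) * (3/4) powr (5 * L / ln L) + 2 * exp (- L)
      + 12 * (L powr (1/5))\<^sup>2 * exp (- (5 * L / ln L) / (64 * (L powr (1/5)) ^ 4)) \<le> exp (- (L powr (1/6)))"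
    and cod: "27 / 10 * (L / ln (L powr (1/5) - 1) + 1) \<le> 14 / ln L * L"
  shows "\<exists>(V::nat set) (E::nat set set).
    finite V \<and> card V = n \<and> simple_graph V E \<and>
    real (card E) \<ge> (real n)\<^sup>2 / 4 * (1 - exp (- (ln (real n) powr (1/6)))) \<and>
    (\<forall>e\<in>E. card (triangles_containing V E e) \<ge> 1) \<and>
    (\<forall>e\<in>E. real (card (triangles_containing V E e)) \<le> real n powr (14 / ln (ln (real n))))"
proof -
  define q where "q = L powr (1/5)"
  define r where "r = nat \<lfloor>q\<rfloor>"
  have r: "real r \<le> q" "q - 1 \<le> real r" "8 \<le> r"
    using q unfolding r_def q_def by linarith+
  have q9: "9 \<le> q" using q unfolding q_def .
  obtain d where d: "1 \<le> d" "n \<le> r ^ d" "r ^ (d - 1) < n"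
    using least_power_exponent[of r n] r(3) n by auto
  have rd: "real r ^ d \<le> real r * real n"
  proof -
    have "r ^ d = r * r ^ (d - 1)" using d(1) by (simp add: power_eq_if)
    also have "\<dots> \<le> r * n" using d(3) by (intro mult_left_mono) auto
    finally show ?thesis by (metis of_nat_le_iff of_nat_mult of_nat_power)
  qed
  have ln_q: "ln q = ln L / 5" using L unfolding q_def by (simp add: ln_powr)
  have "0 < ln L" using L by simp
  have ln_r: "0 < ln (q - 1)" "ln (q - 1) \<le> ln (real r)" "ln (real r) \<le> ln L / 5"
    using r q9 unfolding ln_q[symmetric] by simp_all
  \<comment> \<open>\<open>n \<le> r ^ d\<close> gives this lower bound, which controls the edge
    loss; minimality of \<open>d\<close> gives the upper bound, which controls the
    codegrees.\<close>
  have d_lower: "5 * L / ln L \<le> real d"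
  proof -
    have "L \<le> ln (real r ^ d)"
      unfolding L_def using d(2) n r(3) by (subst ln_le_cancel_iff) (simp_all flip: of_nat_power)
    also have "\<dots> = real d * ln (real r)" using r(3) by (simp add: ln_realpow)
    also have "\<dots> \<le> real d * (ln L / 5)" using ln_r(3) by (intro mult_left_mono) auto
    finally show ?thesis using \<open>0 < ln L\<close> by (simp add: field_simps)
  qed
  have d_upper: "real d \<le> L / ln (q - 1) + 1"
  proof -
    have "real (d - 1) * ln (q - 1) \<le> real (d - 1) * ln (real r)"
      using ln_r(2) by (intro mult_left_mono) auto
    also have "\<dots> = ln (real r ^ (d - 1))" using r(3) by (simp add: ln_realpow)
    also have "\<dots> \<le> L"
      unfolding L_def using d(3) n r(3) by (subst ln_le_cancel_iff) (simp_all flip: of_nat_power)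
    finally have "real (d - 1) \<le> L / ln (q - 1)"
      using ln_r(1) by (simp add: field_simps)
    then show ?thesis using d(1) by (simp add: of_nat_diff)
  qed
  define x where "x = exp (- real d / (64 * real r ^ 4))"
  have loss': "2 * real r * (3/4) ^ d + 2 / real n + 12 * (real r)\<^sup>2 * x \<le> exp (- (L powr (1/6)))"
  proof -
    have "(3/4::real) ^ d \<le> (3/4) powr (5 * L / ln L)"
      using d_lower by (simp add: powr_realpow[symmetric] powr_mono')
    then have "2 * real r * (3/4) ^ d \<le> 2 * q * (3/4) powr (5 * L / ln L)"
      using r(1) q9 by (intro mult_mono) auto
    moreover have "2 / real n = 2 * exp (- L)"
      using n unfolding L_def by (simp add: exp_minus divide_inverse)
    moreover have "12 * (real r)\<^sup>2 * x \<le> 12 * q\<^sup>2 * exp (- (5 * L / ln L) / (64 * q ^ 4))"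
    proof (intro mult_mono power_mono r)
      \<comment> \<open>Replacing \<open>r\<close> by the larger \<open>q\<close> and
        \<open>d\<close> by its lower bound only weakens the decay.\<close>
      have "5 * L / ln L / (64 * q ^ 4) \<le> real d / (64 * real r ^ 4)"
        using d_lower r q9 by (intro frac_le mult_left_mono power_mono) auto
      then show "x \<le> exp (- (5 * L / ln L) / (64 * q ^ 4))"
        unfolding x_def by simp
    qed (auto simp: x_def)
    ultimately show ?thesis using loss unfolding q_def[symmetric] by linarith
  qed
  let ?c = "card (coarse_box r d)"
  have c: "real ?c \<le> (3 / 4 * real r) ^ d" by (rule card_coarse_box_le[OF r(3)])
  have "?c \<le> n"
  proof -
    \<comment> \<open>The loss bound already contains this: the total is at most 1 and no summand is
      negative.\<close>
    have "0 \<le> 2 / real n" "0 \<le> 12 * (real r)\<^sup>2 * x" unfolding x_def by simp_all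
    moreover have "exp (- (L powr (1/6))) \<le> 1" by simp
    ultimately have small: "real r * (3/4) ^ d \<le> 1" using loss' by linarith
    have "real ?c \<le> (3/4) ^ d * real r ^ d" using c by (simp only: power_mult_distrib)
    also have "\<dots> \<le> (3/4) ^ d * (real r * real n)" using rd by (intro mult_left_mono) auto
    also have "\<dots> = (real r * (3/4) ^ d) * real n" by simp
    also have "\<dots> \<le> 1 * real n" using small by (intro mult_right_mono) auto
    finally show ?thesis by simp
  qed
  from lattice_triangle_graph[OF r(3) d(2) this] obtain V :: "nat set" and E where
    V: "finite V" "card V = n" "simple_graph V E" and
    E: "(real ((n - ?c) div 2))\<^sup>2 - 3 * real r ^ (2 * d) * x \<le> real (card E)" and
    T: "\<And>e. e \<in> E \<Longrightarrow> 1 \<le> card (triangles_containing V E e)"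
       "\<And>e. e \<in> E \<Longrightarrow> card (triangles_containing V E e) \<le> 12 ^ d"
    unfolding x_def by blast
  have "1 \<le> n" "0 \<le> x" using n unfolding x_def by simp_all
  from edge_count_lower_bound[OF this(1) c rd loss' this(2) \<open>?c \<le> n\<close>] E
  have edges: "(real n)\<^sup>2 / 4 * (1 - exp (- (L powr (1/6)))) \<le> real (card E)" by linarith
  have "real (12 ^ d) \<le> real n powr (14 / ln L)"
  proof -
    have "real (12 ^ d) = exp (real d * ln 12)" by (simp add: exp_of_nat_mult)
    also have "\<dots> \<le> exp (14 / ln L * L)"
    proof -
      have "ln 12 * real d \<le> 27 / 10 * (L / ln (q - 1) + 1)"
        using d_upper ln_12_le by (intro mult_mono) auto
      from order_trans[OF this cod[folded q_def]] show ?thesis by (simp add: mult.commute)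
    qed
    also have "\<dots> = real n powr (14 / ln L)" using n unfolding L_def by (simp add: powr_def)
    finally show ?thesis .
  qed
  then have "real (card (triangles_containing V E e)) \<le> real n powr (14 / ln L)" if "e \<in> E" for e
    using T(2)[OF that] by (meson of_nat_le_iff order_trans)
  with V edges T(1) show ?thesis unfolding L_def by blast
qed

theorem theorem1p1:
  shows "\<exists>n0::nat. \<forall>n\<ge>n0. \<exists>(V::nat set) (E::nat set set).
    finite V \<and> card V = n \<and> simple_graph V E \<and>
    real (card E) \<ge> (real n)\<^sup>2 / 4 * (1 - exp (- (ln (real n) powr (1/6)))) \<and>
    (\<forall>e\<in>E. card (triangles_containing V E e) \<ge> 1) \<and>
    (\<forall>e\<in>E. real (card (triangles_containing V E e)) \<le> real n powr (14 / ln (ln (real n))))"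
proof -
  \<comment> \<open>This transfers each estimate valid for all large \<open>L\<close> to
    \<open>L = ln n\<close> for all large \<open>n\<close>.\<close>
  have lim: "filterlim (\<lambda>n. ln (real n)) at_top sequentially"
    by (rule filterlim_compose[OF ln_at_top filterlim_real_sequentially])
  note ev = eventually_gt_at_top[of "1::real"] eventually_root5_ge eventually_edge_loss_le
    eventually_codegree_exponent_le
  note evn = ev[THEN eventually_compose_filterlim[OF _ lim]]
  have "\<forall>\<^sub>F n::nat in sequentially. \<exists>(V::nat set) (E::nat set set).
    finite V \<and> card V = n \<and> simple_graph V E \<and>
    real (card E) \<ge> (real n)\<^sup>2 / 4 * (1 - exp (- (ln (real n) powr (1/6)))) \<and>
    (\<forall>e\<in>E. card (triangles_containing V E e) \<ge> 1) \<and>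
    (\<forall>e\<in>E. real (card (triangles_containing V E e)) \<le> real n powr (14 / ln (ln (real n))))"
    using eventually_ge_at_top[of "2::nat"] evn
    by eventually_elim (rule dense_graph_with_small_codegrees)
  then show ?thesis unfolding eventually_sequentially .
qed

end
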